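(* Let $G$ be a connected simple graph of order at least $2$. If $D$ is a differential set in $\operatorname{S}(G)$, then $|D|\le \alpha(\operatorname{S}(G))$.
   Context: All graphs are finite. For a simple graph $H$ and $D\subseteq V(H)$, let $B_H(D)$ be the set of vertices in $V(H)\setminus D$ that have a neighbour in $D$, and let $\partial(D)=|B_H(D)|-|D|$; the differential of $H$ is $\partial(H)=\max\{\partial(D): D\subseteq V(H)\}$, and $D\subseteq V(H)$ is a differential set of $H$ if $\partial(D)=\partial(H)$. $\alpha(H)$ is the independence number of $H$ (maximum size of a set of pairwise non-adjacent vertices). For a simple graph $G$, the subdivision graph $\operatorname{S}(G)$ is the bipartite graph with vertex set the disjoint union $V(G)\cup E(G)$ in which $v\in V(G)$ and $e\in E(G)$ are adjacent if and only if $e$ is incident with $v$ in $G$. *)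

theory Defs
  imports "Graph_Theory.Graph_Theory"
begin

text \<open>
  Finite simple graphs are the instances of the locale \<^locale>\<open>pair_graph\<close>: finite, loop-free,
  symmetric sets of ordered pairs, so that an edge \<open>uv\<close> is represented by both \<open>(u, v)\<close> and
  \<open>(v, u)\<close>.
\<close>

definition boundary :: "'a pair_pre_digraph \<Rightarrow> 'a set \<Rightarrow> 'a set" where
  "boundary H D = {v \<in> pverts H - D. \<exists>u \<in> D. (u, v) \<in> parcs H}"

definition set_differential :: "'a pair_pre_digraph \<Rightarrow> 'a set \<Rightarrow> int" where
  "set_differential H D = int (card (boundary H D)) - int (card D)"

definition differential :: "'a pair_pre_digraph \<Rightarrow> int" where
  "differential H = Max {set_differential H D | D. D \<subseteq> pverts H}"

definition differential_set :: "'a pair_pre_digraph \<Rightarrow> 'a set \<Rightarrow> bool" where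
  "differential_set H D \<longleftrightarrow> D \<subseteq> pverts H \<and> set_differential H D = differential H"

definition independent_set :: "'a pair_pre_digraph \<Rightarrow> 'a set \<Rightarrow> bool" where
  "independent_set H A \<longleftrightarrow> A \<subseteq> pverts H \<and> pairwise (\<lambda>u v. (u, v) \<notin> parcs H) A"

definition independence_number :: "'a pair_pre_digraph \<Rightarrow> nat" where
  "independence_number H = Max {card A | A. independent_set H A}"

text \<open>Undirected edges, as two-element sets of end vertices.\<close>

definition edges :: "'a pair_pre_digraph \<Rightarrow> 'a set set" where
  "edges G = {{u, v} | u v. (u, v) \<in> parcs G}"

definition subdivision_graph :: "'a pair_pre_digraph \<Rightarrow> ('a + 'a set) pair_pre_digraph" where
  "subdivision_graph G =
    \<lparr> pverts = pverts G <+> edges G,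
      parcs = {(Inl v, Inr e) | v e. v \<in> pverts G \<and> e \<in> edges G \<and> v \<in> e}
            \<union> {(Inr e, Inl v) | v e. v \<in> pverts G \<and> e \<in> edges G \<and> v \<in> e} \<rparr>"

lemma pair_graph_subdivision_graph:
  assumes "pair_graph G"
  shows "pair_graph (subdivision_graph G)"
proof -
  interpret pair_graph G by fact
  have "edges G = (\<lambda>(u, v). {u, v}) ` parcs G"
    unfolding edges_def by auto
  then have finE: "finite (edges G)" using pair_finite_arcs by simp
  then have finV: "finite (pverts (subdivision_graph G))"
    using pair_finite_verts by (simp add: subdivision_graph_def)
  have sub: "parcs (subdivision_graph G)
      \<subseteq> pverts (subdivision_graph G) \<times> pverts (subdivision_graph G)"
    by (auto simp: subdivision_graph_def)
  have finA: "finite (parcs (subdivision_graph G))"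
    using finite_subset[OF sub] finV by blast
  have sym: "symmetric (with_proj (subdivision_graph G))"
    unfolding symmetric_def by (auto simp: subdivision_graph_def intro!: symI)
  have nl: "e \<in> parcs (subdivision_graph G) \<Longrightarrow> fst e \<noteq> snd e" for e
    by (auto simp: subdivision_graph_def)
  show ?thesis
    by unfold_locales (use sub finV finA sym nl in auto)
qed

end

theory Submission
  imports Defs
begin

text \<open>
  The bound compares both sides with half the order of the subdivision graph. The empty set has differential
  0, so a differential set \<open>D\<close> has at least \<open>card D\<close> boundary vertices; as these lie outside
  \<open>D\<close>, the set \<open>D\<close> contains at most half of all vertices (\<open>differential_set_card_le\<close>). On the
  other hand, the original vertices and the subdivision vertices are two independent sets that
  cover the subdivision graph, so the larger one contains at least half of all vertices
  (\<open>bipartite_card_le\<close>).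
\<close>

lemma set_differential_le_differential:
  assumes "finite (pverts H)" and "D \<subseteq> pverts H"
  shows "set_differential H D \<le> differential H"
proof -
  have "{set_differential H D | D. D \<subseteq> pverts H} = set_differential H ` Pow (pverts H)"
    by auto
  with assms show ?thesis
    unfolding differential_def by (intro Max_ge) auto
qed

lemma card_le_independence_number:
  assumes "finite (pverts H)" and "independent_set H A"
  shows "card A \<le> independence_number H"
proof -
  have "{card A | A. independent_set H A} \<subseteq> card ` Pow (pverts H)"
    by (auto simp: independent_set_def)
  then have "finite {card A | A. independent_set H A}"
    using assms(1) finite_subset by blast
  with assms(2) show ?thesis
    unfolding independence_number_def by (intro Max_ge) auto
qed

lemma differential_set_card_le:
  assumes "finite (pverts H)" and "differential_set H D"
  shows "2 * card D \<le> card (pverts H)"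
proof -
  have D: "D \<subseteq> pverts H" and diff: "set_differential H D = differential H"
    using assms(2) by (auto simp: differential_set_def)
  have "set_differential H {} = 0"
    by (simp add: set_differential_def boundary_def)
  then have "0 \<le> set_differential H D"
    using set_differential_le_differential[OF assms(1), of "{}"] diff by simp
  then have "card D \<le> card (boundary H D)"
    by (simp add: set_differential_def)
  also have "\<dots> \<le> card (pverts H - D)"
    using assms(1) by (intro card_mono) (auto simp: boundary_def)
  also have "\<dots> = card (pverts H) - card D"
    using D assms(1) by (intro card_Diff_subset) (auto intro: finite_subset)
  finally show ?thesis
    using card_mono[OF assms(1) D] by linarith
qed

lemma bipartite_card_le:
  assumes "finite (pverts H)" and "pverts H = A \<union> B"
    and "independent_set H A" and "independent_set H B"
  shows "card (pverts H) \<le> 2 * independence_number H"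
proof -
  have "card (pverts H) \<le> card A + card B"
    using assms(2) card_Un_le by simp
  also have "\<dots> \<le> 2 * independence_number H"
    using card_le_independence_number[OF assms(1)] assms(3,4) by (metis add_mono mult_2)
  finally show ?thesis .
qed

lemma subdivision_graph_bipartite:
  shows "pverts (subdivision_graph G) = Inl ` pverts G \<union> Inr ` edges G"
    and "independent_set (subdivision_graph G) (Inl ` pverts G)"
    and "independent_set (subdivision_graph G) (Inr ` edges G)"
  by (auto simp: subdivision_graph_def independent_set_def pairwise_def)

theorem corollary2p20:
  fixes G :: "'a pair_pre_digraph" and D :: "('a + 'a set) set"
  assumes "pair_graph G"
    and "Digraph_Component.connected G"
    and "card (pverts G) \<ge> 2"
    and "differential_set (subdivision_graph G) D"
  shows "card D \<le> independence_number (subdivision_graph G)"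
proof -
  interpret S: pair_graph "subdivision_graph G"
    using assms(1) by (rule pair_graph_subdivision_graph)
  have "2 * card D \<le> card (pverts (subdivision_graph G))"
    using S.pair_finite_verts assms(4) by (rule differential_set_card_le)
  also have "\<dots> \<le> 2 * independence_number (subdivision_graph G)"
    using S.pair_finite_verts subdivision_graph_bipartite by (rule bipartite_card_le)
  finally show ?thesis
    by simp
qed

end
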